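(* Let $P(z)$ be a polynomial whose zeros are all simple and all lie outside or on the unit circle $|z|=1$. Let $\frac{1}{P(z)}=\sum_{n\ge0}a_nz^n$ be the Taylor expansion at $z=0$ of $1/P(z)$, and for $N\ge1$ let $$W_N(z):=\sum_{n=0}^{N}\left(1-\frac nN\right)a_nz^n.$$ Then, as $N\to\infty$, $$\frac{1}{2\pi}\int_0^{2\pi}\bigl|1-P(e^{i\theta})W_N(e^{i\theta})\bigr|^2\,d\theta\sim\frac1N\sum_{|\rho|=1}m(\rho)^2,$$ where the sum is over the distinct zeros $\rho$ of $P$ lying on the unit circle and $m(\rho)$ denotes the multiplicity of $\rho$.
   Formalization: If P has no zero on the unit circle the right side is 0 and "∼" fails (e.g. P(z)=z−2, where the left side has order 1/N²); there it is read as: the left side is o(1/N). The relation ∼ itself is stated when P has at least one zero on the unit circle. *)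

theory Defs
  imports "HOL-Complex_Analysis.Complex_Analysis" "HOL-Library.Landau_Symbols"
begin

definition taylor_coeff :: "complex poly \<Rightarrow> nat \<Rightarrow> complex" where
  "taylor_coeff P n = fps_nth (fps_expansion (\<lambda>z. 1 / poly P z) 0) n"

(* Only meant for N >= 1; at N = 0 the weight n / N is the junk value 0. *)
definition W :: "complex poly \<Rightarrow> nat \<Rightarrow> complex \<Rightarrow> complex" where
  "W P N z = (\<Sum>n=0..N. of_real (1 - real n / real N) * taylor_coeff P n * z ^ n)"

definition mean_square_error :: "complex poly \<Rightarrow> nat \<Rightarrow> real" where
  "mean_square_error P N =
     1 / (2 * pi) *
       integral {0..2 * pi} (\<lambda>\<theta>. (cmod (1 - poly P (cis \<theta>) * W P N (cis \<theta>)))\<^sup>2)"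

definition unit_circle_zeros :: "complex poly \<Rightarrow> complex set" where
  "unit_circle_zeros P = {\<rho>. poly P \<rho> = 0 \<and> cmod \<rho> = 1}"

end

theory Submission
  imports Defs "HOL-Computational_Algebra.Fundamental_Theorem_Algebra"
begin

text \<open>
  Since \<open>\<Sum>j\<le>k. p\<^sub>j a\<^sub>k\<^sub>-\<^sub>j = [k = 0]\<close>, the coefficient of \<open>z\<^sup>k\<close> in \<open>1 - P W\<^sub>N\<close> for \<open>k \<le> N\<close> is \<open>- 1 / N\<close>
  times the \<open>k\<close>-th coefficient of \<open>z P' / P\<close>, that is, \<open>(\<Sum>\<rho>. \<rho> powi (-k)) / N\<close> for \<open>k \<ge> 1\<close> and \<open>0\<close>
  for \<open>k = 0\<close>. The simplicity of the zeros makes the \<open>a\<^sub>n\<close> bounded, so each of the remaining \<open>deg P\<close>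
  coefficients is \<open>O(1 / N)\<close>. By Parseval, \<open>N\<close> times the mean square error is therefore the Cesaro mean of
  \<open>\<bar>\<Sum>\<rho>. \<rho> powi (-k)\<bar>\<^sup>2\<close> up to \<open>O(1 / N)\<close>. Expanding the square, only the diagonal terms of zeros
  on the unit circle survive in the limit.
\<close>

section \<open>Parseval's identity for polynomials on the unit circle\<close>

lemma has_integral_cis_int:
  fixes m :: int
  shows "((\<lambda>t. cis (of_int m * t)) has_integral (if m = 0 then 2 * of_real pi else 0)) {0..2 * pi}"
proof (cases "m = 0")
  case True
  have "((\<lambda>_. 1 :: complex) has_integral (2 * pi - 0) *\<^sub>R 1) {0..2 * pi}"
    using has_integral_const_real[of "1 :: complex" 0 "2 * pi"] by simp
  then show ?thesis using True by (simp add: scaleR_conv_of_real)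
next
  case False
  let ?F = "\<lambda>t. cis (of_int m * t) / (\<i> * of_int m)"
  have "((\<lambda>t. cis (of_int m * t)) has_integral (?F (2 * pi) - ?F 0)) {0..2 * pi}"
  proof (rule fundamental_theorem_of_calculus)
    fix t
    \<comment> \<open>The antiderivative is differentiated as an entire function and then restricted
      to the real axis.\<close>
    have "((\<lambda>z. exp (\<i> * of_int m * z) / (\<i> * of_int m)) has_field_derivative exp (\<i> * of_int m * of_real t))
        (at (of_real t))"
      using False by (auto intro!: derivative_eq_intros)
    from has_vector_derivative_real_field[OF this]
    show "(?F has_vector_derivative cis (of_int m * t)) (at t within {0..2 * pi})"
      by (simp add: cis_conv_exp mult.assoc)
  qed auto
  moreover have "cis (of_int m * (2 * pi)) = 1"
    using cis_multiple_2pi[of "of_int m"] by (simp add: mult_ac)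
  ultimately show ?thesis using False by simp
qed

text \<open>Expanding the square as a double sum reduces the integral to those of
  \<open>cis ((j - k) * t)\<close>, of which only the diagonal ones survive. The free bound
  \<open>n\<close> allows use with a mere upper bound for the degree, as is available for the error
  polynomial.\<close>

lemma parseval_poly:
  fixes E :: "complex poly"
  assumes "degree E \<le> n"
  shows "integral {0..2 * pi} (\<lambda>t. (cmod (poly E (cis t)))\<^sup>2) = 2 * pi * (\<Sum>k\<le>n. (cmod (coeff E k))\<^sup>2)"
proof -
  have ev: "poly E z = (\<Sum>k\<le>n. coeff E k * z ^ k)" for z
    unfolding poly_altdef using assms by (intro sum.mono_neutral_left) (auto simp: coeff_eq_0)
  have sq: "of_real ((cmod (poly E (cis t)))\<^sup>2) =
      (\<Sum>j\<le>n. \<Sum>k\<le>n. coeff E j * cnj (coeff E k) * cis (of_int (int j - int k) * t))" for t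
  proof -
    have "cis t ^ j * cnj (cis t ^ k) = cis (of_int (int j - int k) * t)" for j k
      by (simp only: Complex.DeMoivre cis_cnj cis_mult) (simp add: algebra_simps)
    then show ?thesis
      unfolding complex_norm_square ev cnj_sum sum_product
      by (intro sum.cong refl) (metis (no_types, lifting) complex_cnj_mult mult.assoc mult.left_commute)
  qed
  have "((\<lambda>t. \<Sum>j\<le>n. \<Sum>k\<le>n. coeff E j * cnj (coeff E k) * cis (of_int (int j - int k) * t)) has_integral
     (\<Sum>j\<le>n. \<Sum>k\<le>n. coeff E j * cnj (coeff E k) * (if int j - int k = 0 then 2 * of_real pi else 0)))
     {0..2 * pi}"
    by (intro has_integral_sum has_integral_mult_right has_integral_cis_int) auto
  also have "(\<Sum>j\<le>n. \<Sum>k\<le>n. coeff E j * cnj (coeff E k) * (if int j - int k = 0 then 2 * of_real pi else 0))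
    = (\<Sum>j\<le>n. \<Sum>k\<le>n. if j = k then of_real (2 * pi * (cmod (coeff E j))\<^sup>2) else 0)"
    by (intro sum.cong refl) (simp add: complex_norm_square mult_ac del: of_real_power)
  also have "\<dots> = (of_real (2 * pi * (\<Sum>k\<le>n. (cmod (coeff E k))\<^sup>2)) :: complex)"
    by (simp add: sum_distrib_left)
  finally have "((\<lambda>t. complex_of_real ((cmod (poly E (cis t)))\<^sup>2)) has_integral
      of_real (2 * pi * (\<Sum>k\<le>n. (cmod (coeff E k))\<^sup>2))) {0..2 * pi}"
    unfolding sq .
  from has_integral_Re[OF this] show ?thesis
    by (intro integral_unique) (simp del: of_real_power)
qed

section \<open>Cesaro means of powers and of power sums\<close>

lemma cesaro_mean_powers:
  fixes w :: complex
  assumes "cmod w \<le> 1"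
  shows "(\<lambda>N. (\<Sum>k=1..N. w ^ k) / of_nat N) \<longlonglongrightarrow> (if w = 1 then 1 else 0)"
proof (cases "w = 1")
  case True
  have "eventually (\<lambda>N. (\<Sum>k=1..N. w ^ k) / of_nat N = 1) sequentially"
    using eventually_gt_at_top[of 0] by eventually_elim (simp add: True)
  then show ?thesis using True by (simp add: tendsto_eventually)
next
  case False
  \<comment> \<open>The closed form of the geometric sum is bounded by
    \<open>2 / cmod (1 - w)\<close> uniformly in \<open>N\<close>, so division by \<open>N\<close>
    sends it to 0.\<close>
  have "(\<Sum>k=1..N. w ^ k) * (1 - w) = w - w ^ Suc N" for N
  proof (induction N)
    case (Suc N)
    have "(\<Sum>k=1..Suc N. w ^ k) * (1 - w) = (\<Sum>k=1..N. w ^ k) * (1 - w) + w ^ Suc N * (1 - w)"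
      by (simp add: distrib_right)
    then show ?case unfolding Suc by (simp add: right_diff_distrib)
  qed simp
  then have gp: "(\<Sum>k=1..N. w ^ k) = (w - w ^ Suc N) / (1 - w)" for N
    using False by (simp add: eq_divide_eq)
  have bd: "cmod (w - w ^ Suc N) \<le> 2" for N
    using norm_triangle_ineq4[of w "w ^ Suc N"] assms power_le_one[of "cmod w" "Suc N"]
    by (simp add: norm_power norm_mult)
  have "(\<lambda>N. (\<Sum>k=1..N. w ^ k) / of_nat N) \<longlonglongrightarrow> 0"
  proof (rule Lim_null_comparison)
    show "eventually (\<lambda>N. cmod ((\<Sum>k=1..N. w ^ k) / of_nat N) \<le> 2 / cmod (1 - w) / real N) sequentially"
      unfolding gp norm_divide by (intro always_eventually allI) (use bd in \<open>auto intro!: divide_right_mono\<close>)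
    show "(\<lambda>N. 2 / cmod (1 - w) / real N) \<longlonglongrightarrow> 0" by real_asymp
  qed
  then show ?thesis using False by simp
qed

text \<open>The squared modulus is a double sum over \<open>z\<close> and \<open>u\<close> of powers
  of \<open>z * cnj u\<close>. Within the closed unit disc this product equals 1 only if
  \<open>u = z\<close> lies on the circle, so the limit gets a contribution 1 from each such point
  and nothing from any other pair.\<close>

lemma cesaro_mean_power_sums:
  fixes Z :: "complex set"
  assumes "finite Z" and "\<And>z. z \<in> Z \<Longrightarrow> cmod z \<le> 1"
  shows "(\<lambda>N. (\<Sum>k=1..N. (cmod (\<Sum>z\<in>Z. z ^ k))\<^sup>2) / real N) \<longlonglongrightarrow> real (card {z\<in>Z. cmod z = 1})"
proof -
  have eq: "complex_of_real ((\<Sum>k=1..N. (cmod (\<Sum>z\<in>Z. z ^ k))\<^sup>2) / real N) =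
      (\<Sum>z\<in>Z. \<Sum>u\<in>Z. (\<Sum>k=1..N. (z * cnj u) ^ k) / of_nat N)" for N
  proof -
    have "complex_of_real ((\<Sum>k=1..N. (cmod (\<Sum>z\<in>Z. z ^ k))\<^sup>2) / real N) =
        (\<Sum>k=1..N. \<Sum>z\<in>Z. \<Sum>u\<in>Z. (z * cnj u) ^ k) / of_nat N"
      by (simp only: of_real_divide of_real_sum complex_norm_square cnj_sum sum_product
          complex_cnj_power power_mult_distrib of_real_of_nat_eq)
    also have "(\<Sum>k=1..N. \<Sum>z\<in>Z. \<Sum>u\<in>Z. (z * cnj u) ^ k) = (\<Sum>z\<in>Z. \<Sum>k=1..N. \<Sum>u\<in>Z. (z * cnj u) ^ k)"
      by (rule sum.swap)
    also have "\<dots> = (\<Sum>z\<in>Z. \<Sum>u\<in>Z. \<Sum>k=1..N. (z * cnj u) ^ k)"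
      by (intro sum.cong refl sum.swap)
    finally show ?thesis by (simp add: sum_divide_distrib)
  qed
  have one: "z * cnj u = 1 \<longleftrightarrow> u = z \<and> cmod z = 1" if "z \<in> Z" "u \<in> Z" for z u
  proof
    assume "z * cnj u = 1"
    then have "cmod z * cmod u = 1" by (metis complex_mod_cnj norm_mult norm_one)
    moreover have "cmod z \<le> 1" "cmod u \<le> 1" using assms that by auto
    ultimately have "cmod z = 1" "cmod u = 1"
      by (smt (verit) mult_left_le mult_left_le_one_le norm_ge_zero)+
    \<comment> \<open>Now \<open>cnj u\<close> is inverse to both \<open>u\<close> and
      \<open>z\<close>, hence they coincide.\<close>
    then have "u * cnj u = 1" by (simp add: complex_norm_square[symmetric])
    then show "u = z \<and> cmod z = 1"
      using \<open>z * cnj u = 1\<close> \<open>cmod z = 1\<close>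
      by (metis mult.commute mult.left_commute mult_1_right)
  qed (simp add: complex_norm_square[symmetric])
  have "(\<lambda>N. \<Sum>z\<in>Z. \<Sum>u\<in>Z. (\<Sum>k=1..N. (z * cnj u) ^ k) / of_nat N) \<longlonglongrightarrow>
      (\<Sum>z\<in>Z. \<Sum>u\<in>Z. if z * cnj u = 1 then 1 else 0)"
    by (intro tendsto_sum cesaro_mean_powers) (use assms in \<open>auto simp: norm_mult intro: mult_le_one\<close>)
  also have "(\<Sum>z\<in>Z. \<Sum>u\<in>Z. if z * cnj u = 1 then 1 else 0) = (\<Sum>z\<in>Z. if cmod z = 1 then 1 else (0::complex))"
  proof (intro sum.cong refl)
    fix z assume "z \<in> Z"
    then have "(\<Sum>u\<in>Z. if z * cnj u = 1 then 1 else 0) = (\<Sum>u\<in>Z. if u = z then (if cmod z = 1 then 1 else 0) else (0::complex))"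
      using one by (intro sum.cong) auto
    then show "(\<Sum>u\<in>Z. if z * cnj u = 1 then 1 else 0) = (if cmod z = 1 then 1 else (0::complex))"
      using \<open>z \<in> Z\<close> assms(1) by simp
  qed
  also have "\<dots> = of_real (real (card {z\<in>Z. cmod z = 1}))"
    using assms(1) by (simp add: sum.inter_filter[symmetric])
  finally show ?thesis
    unfolding eq[symmetric] tendsto_of_real_iff .
qed

section \<open>Partial fractions over a squarefree denominator\<close>

lemma card_roots_rsquarefree:
  fixes P :: "complex poly"
  assumes "rsquarefree P"
  shows "card {z. poly P z = 0} = degree P"
proof -
  have "P \<noteq> 0" using assms by (simp add: rsquarefree_def)
  have "P = smult (lead_coeff P) (\<Prod>z|poly P z = 0. [:-z, 1:])"
    using complex_poly_decompose_rsquarefree[OF assms] by simp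
  then have "degree P = degree (\<Prod>z|poly P z = 0. [:-z, 1:])"
    using \<open>P \<noteq> 0\<close> by (metis degree_smult_eq leading_coeff_0_iff)
  also have "\<dots> = card {z. poly P z = 0}"
    by (subst degree_prod_eq_sum_degree) auto
  finally show ?thesis ..
qed

text \<open>Lagrange interpolation at the zeros of \<open>P\<close>: both sides have degree below
  \<open>degree P\<close>, which is the number of zeros, so agreement at the zeros suffices. The
  cofactor belonging to one zero vanishes at all the others.\<close>

lemma lagrange_rsquarefree:
  fixes P Q :: "complex poly"
  assumes "rsquarefree P" and "degree Q < degree P"
  shows "Q = (\<Sum>\<rho>|poly P \<rho> = 0. smult (poly Q \<rho> / poly (pderiv P) \<rho>) (P div [:-\<rho>, 1:]))"
    (is "Q = ?R")
proof (rule poly_eqI_degree)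
  let ?Z = "{z. poly P z = 0}"
  have P: "P \<noteq> 0" using assms by (simp add: rsquarefree_def)
  have fin: "finite ?Z" using P by (rule poly_roots_finite)
  have fac: "P = [:-\<rho>, 1:] * (P div [:-\<rho>, 1:])" if "poly P \<rho> = 0" for \<rho>
    using that unfolding poly_eq_0_iff_dvd by (rule dvd_mult_div_cancel[symmetric])
  show "poly Q z = poly ?R z" if z: "z \<in> ?Z" for z
  proof -
    have "poly (P div [:-\<rho>, 1:]) z = (if \<rho> = z then poly (pderiv P) z else 0)" if "\<rho> \<in> ?Z" for \<rho>
    proof -
      define D where "D = P div [:-\<rho>, 1:]"
      have PD: "P = [:-\<rho>, 1:] * D" using fac that by (simp add: D_def)
      \<comment> \<open>In the product rule for \<open>P\<close>, the term still containing the
        linear factor vanishes at its zero.\<close>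
      have "poly (pderiv P) \<rho> = poly D \<rho>"
        by (subst PD) (simp add: pderiv_mult pderiv_pCons del: mult_pCons_left)
      moreover have "(z - \<rho>) * poly D z = 0"
        using z by (subst (asm) PD) (simp add: left_diff_distrib)
      ultimately show ?thesis by (auto simp: D_def)
    qed
    then have "poly ?R z = (\<Sum>\<rho>\<in>?Z. if \<rho> = z then poly Q z / poly (pderiv P) z * poly (pderiv P) z else 0)"
      unfolding poly_sum by (intro sum.cong) auto
    \<comment> \<open>Squarefreeness makes \<open>P'\<close> nonzero at \<open>z\<close>, so the
      quotient cancels.\<close>
    also have "\<dots> = poly Q z"
      using z fin assms(1) by (auto simp: rsquarefree_roots)
    finally show ?thesis ..
  qed
  show "card ?Z > degree Q" using assms card_roots_rsquarefree by simp
  have "degree ?R < degree P"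
  proof (rule degree_sum_less)
    fix \<rho> assume \<rho>: "\<rho> \<in> ?Z"
    define D where "D = P div [:-\<rho>, 1:]"
    have PD: "P = [:-\<rho>, 1:] * D" using fac \<rho> by (simp only: D_def mem_Collect_eq)
    then have "D \<noteq> 0" using P by auto
    then have "degree P = Suc (degree D)"
      by (subst PD) (subst degree_mult_eq, auto)
    then show "degree (smult (poly Q \<rho> / poly (pderiv P) \<rho>) (P div [:-\<rho>, 1:])) < degree P"
      unfolding D_def[symmetric] by (metis degree_smult_le le_imp_less_Suc)
  qed (use assms in auto)
  then show "card ?Z > degree ?R" using assms card_roots_rsquarefree by simp
qed

text \<open>Dividing the interpolation formula by \<open>P\<close> gives the partial fractions of
  \<open>Q / P\<close>, and each \<open>1 / (z - \<rho>)\<close> is expanded as a geometric series.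
  The case \<open>Q = 1\<close> serves to bound the Taylor coefficients, the case
  \<open>Q = P'\<close> to identify the error coefficients.\<close>

lemma fps_quotient_rsquarefree_nth:
  fixes P Q :: "complex poly"
  assumes "rsquarefree P" and "degree Q < degree P" and P0: "poly P 0 \<noteq> 0"
  shows "fps_nth (fps_of_poly Q * inverse (fps_of_poly P)) n =
    - (\<Sum>\<rho>|poly P \<rho> = 0. poly Q \<rho> / poly (pderiv P) \<rho> * inverse \<rho> ^ Suc n)"
proof -
  let ?I = "inverse (fps_of_poly P)"
  have P0': "fps_nth (fps_of_poly P) 0 \<noteq> 0" using P0 by (simp add: poly_0_coeff_0)
  have one: "fps_of_poly (P div [:-\<rho>, 1:]) * ?I = Abs_fps (\<lambda>n. - (inverse \<rho> ^ Suc n))"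
    if "poly P \<rho> = 0" for \<rho>
  proof -
    define D where "D = P div [:-\<rho>, 1:]"
    let ?G = "Abs_fps (\<lambda>n. - (inverse \<rho> ^ Suc n))"
    have "\<rho> \<noteq> 0" using that P0 by auto
    have PD: "P = [:-\<rho>, 1:] * D" using that unfolding D_def poly_eq_0_iff_dvd by (rule dvd_mult_div_cancel[symmetric])
    have "fps_of_poly [:-\<rho>, 1:] * ?G = 1"
    proof (rule fps_ext)
      fix n
      show "fps_nth (fps_of_poly [:-\<rho>, 1:] * ?G) n = fps_nth 1 n"
        using \<open>\<rho> \<noteq> 0\<close> by (cases n) (simp_all add: fps_of_poly_pCons distrib_right mult.assoc)
    qed
    moreover have "fps_of_poly P * ?G = fps_of_poly D * (fps_of_poly [:-\<rho>, 1:] * ?G)"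
      by (subst PD) (simp only: fps_of_poly_mult mult_ac)
    ultimately have "fps_of_poly P * ?G = fps_of_poly D" by simp
    then have "fps_of_poly D * ?I = (fps_of_poly P * ?I) * ?G" by (simp add: mult_ac)
    then show ?thesis using P0' by (simp add: D_def inverse_mult_eq_1')
  qed
  have "fps_of_poly Q * ?I = (\<Sum>\<rho>|poly P \<rho> = 0. fps_const (poly Q \<rho> / poly (pderiv P) \<rho>) * (fps_of_poly (P div [:-\<rho>, 1:]) * ?I))"
    by (subst lagrange_rsquarefree[OF assms(1,2)])
       (simp add: fps_of_poly_sum fps_of_poly_smult sum_distrib_right mult.assoc)
  also have "\<dots> = (\<Sum>\<rho>|poly P \<rho> = 0. fps_const (poly Q \<rho> / poly (pderiv P) \<rho>) * Abs_fps (\<lambda>n. - (inverse \<rho> ^ Suc n)))"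
    using one by (intro sum.cong) auto
  finally show ?thesis by (simp add: fps_sum_nth sum_negf)
qed

section \<open>From the analytic expansion of \<open>1 / P\<close> to the formal inverse\<close>

lemma poly_has_fps_expansion:
  fixes P :: "complex poly"
  shows "poly P has_fps_expansion fps_of_poly P"
proof (induction P)
  case 0
  then show ?case using has_fps_expansion_0 by (simp add: poly_0[abs_def])
next
  case (pCons a P)
  have "(\<lambda>z. a + z * poly P z) has_fps_expansion fps_const a + fps_X * fps_of_poly P"
    by (intro fps_expansion_intros pCons)
  then show ?case by (simp add: fps_of_poly_pCons mult.commute fun_eq_iff)
qed

lemma taylor_coeff_eq:
  assumes "poly P 0 \<noteq> 0"
  shows "taylor_coeff P n = fps_nth (inverse (fps_of_poly P)) n"
proof -
  have "(\<lambda>z. inverse (poly P z)) has_fps_expansion inverse (fps_of_poly P)"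
    by (rule has_fps_expansion_inverse[OF poly_has_fps_expansion]) (use assms in \<open>simp add: poly_0_coeff_0\<close>)
  then show ?thesis
    unfolding taylor_coeff_def by (simp add: fps_expansion_eqI inverse_eq_divide)
qed

section \<open>The error polynomial and its coefficients\<close>

definition W_poly :: "complex poly \<Rightarrow> nat \<Rightarrow> complex poly" where
  "W_poly P N = (\<Sum>n\<le>N. monom (of_real (1 - real n / real N) * taylor_coeff P n) n)"

lemma poly_W_poly: "poly (W_poly P N) z = W P N z"
  by (simp add: W_poly_def W_def poly_sum poly_monom atLeast0AtMost)

lemma coeff_W_poly:
  "coeff (W_poly P N) n = (if n \<le> N then of_real (1 - real n / real N) * taylor_coeff P n else 0)"
  by (simp add: W_poly_def coeff_sum)

lemma degree_W_poly: "degree (W_poly P N) \<le> N"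
  by (rule degree_le) (simp add: coeff_W_poly)

definition error_poly :: "complex poly \<Rightarrow> nat \<Rightarrow> complex poly" where
  "error_poly P N = 1 - P * W_poly P N"

lemma poly_error_poly: "poly (error_poly P N) z = 1 - poly P z * W P N z"
  by (simp add: error_poly_def poly_W_poly)

lemma degree_error_poly: "degree (error_poly P N) \<le> N + degree P"
  unfolding error_poly_def using degree_mult_le[of P "W_poly P N"] degree_W_poly[of P N]
  by (intro degree_diff_le) auto

text \<open>The residues of \<open>P' / P\<close> at simple zeros are all 1. Constants are treated
  separately, because there \<open>P'\<close> does not have smaller degree than
  \<open>P\<close>.\<close>

lemma pderiv_quotient_nth:
  fixes P :: "complex poly"
  assumes "rsquarefree P" and "poly P 0 \<noteq> 0"
  shows "fps_nth (fps_of_poly (pderiv P) * inverse (fps_of_poly P)) n =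
    - (\<Sum>\<rho>|poly P \<rho> = 0. inverse \<rho> ^ Suc n)"
proof (cases "degree P = 0")
  case True
  then obtain c where "P = [:c:]" by (rule degree_eq_zeroE)
  with assms show ?thesis by simp
next
  case False
  have "degree (pderiv P) < degree P" using False by (simp add: degree_pderiv)
  then show ?thesis
    using fps_quotient_rsquarefree_nth[OF assms(1) _ assms(2), of "pderiv P" n] assms(1)
    by (simp add: rsquarefree_roots)
qed

lemma coeff_error_poly_low:
  assumes sf: "rsquarefree P" and P0: "poly P 0 \<noteq> 0" and k: "k \<le> N"
  shows "coeff (error_poly P N) k = (if k = 0 then 0 else (\<Sum>\<rho>|poly P \<rho> = 0. inverse \<rho> ^ k) / of_nat N)"
proof -
  let ?p = "coeff P" and ?a = "taylor_coeff P" and ?I = "inverse (fps_of_poly P)"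
  have "coeff (P * W_poly P N) k = (\<Sum>j\<le>k. ?p j * (of_real (1 - real (k - j) / real N) * ?a (k - j)))"
    unfolding coeff_mult using k by (intro sum.cong) (auto simp: coeff_W_poly)
  \<comment> \<open>The weight splits as \<open>1 - (k - j) / N = (1 - k / N) + j / N\<close>. The
    first part leads to the convolution for \<open>P * (1 / P) = 1\<close>, the second to the one
    for \<open>z * P' / P\<close>.\<close>
  also have "\<dots> = (\<Sum>j\<le>k. (1 - of_nat k / of_nat N) * (?p j * ?a (k - j)) +
      (of_nat j * ?p j * ?a (k - j)) / of_nat N)"
    by (intro sum.cong refl) (auto simp: of_nat_diff algebra_simps diff_divide_distrib)
  also have "\<dots> = (1 - of_nat k / of_nat N) * (\<Sum>j\<le>k. ?p j * ?a (k - j)) +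
      (\<Sum>j\<le>k. of_nat j * ?p j * ?a (k - j)) / of_nat N"
    by (simp add: sum.distrib sum_distrib_left sum_divide_distrib)
  also have "(\<Sum>j\<le>k. ?p j * ?a (k - j)) = fps_nth (fps_of_poly P * ?I) k"
    by (simp add: fps_mult_nth taylor_coeff_eq[OF P0] atLeast0AtMost)
  also have "fps_of_poly P * ?I = 1"
    using P0 by (simp add: inverse_mult_eq_1' poly_0_coeff_0)
  also have "(\<Sum>j\<le>k. of_nat j * ?p j * ?a (k - j)) = fps_nth (fps_X * fps_deriv (fps_of_poly P) * ?I) k"
    by (simp add: fps_mult_nth taylor_coeff_eq[OF P0] atLeast0AtMost fps_mult_fps_X_deriv_shift)
  \<comment> \<open>The factor \<open>fps_X\<close> shifts the index by one, so the coefficient of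
    \<open>P' / P\<close> at \<open>k - 1\<close> supplies the exponent \<open>k\<close>.\<close>
  also have "\<dots> = (if k = 0 then 0 else - (\<Sum>\<rho>|poly P \<rho> = 0. inverse \<rho> ^ k))"
    using pderiv_quotient_nth[OF sf P0, of "k - 1"]
    by (cases k) (simp_all add: fps_of_poly_pderiv mult.assoc)
  finally show ?thesis by (auto simp: error_poly_def)
qed

text \<open>In a nonzero term \<open>j\<close> is at most \<open>degree P\<close> and
  \<open>k - j\<close> is at most \<open>N\<close>. As \<open>k > N\<close>, the index
  \<open>k - j\<close> then lies within \<open>degree P\<close> of \<open>N\<close>, where the
  weight \<open>1 - (k - j) / N\<close> is at most \<open>degree P / N\<close>.\<close>

lemma norm_coeff_error_poly_high:
  assumes B: "\<And>n. cmod (taylor_coeff P n) \<le> B" and k: "N < k" and N: "N > 0"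
  shows "cmod (coeff (error_poly P N) k) \<le> real (degree P) * B * (\<Sum>j\<le>degree P. cmod (coeff P j)) / real N"
proof -
  let ?d = "degree P"
  have "0 \<le> B" using B[of 0] norm_ge_zero order_trans by blast
  have "cmod (coeff (error_poly P N) k) = cmod (\<Sum>j\<le>k. coeff P j * coeff (W_poly P N) (k - j))"
    using k by (simp add: error_poly_def coeff_mult)
  also have "\<dots> \<le> (\<Sum>j\<le>k. cmod (coeff P j) * (real ?d * B / real N))"
  proof (intro sum_norm_le)
    fix j assume "j \<in> {..k}"
    have "cmod (coeff (W_poly P N) (k - j)) \<le> real ?d * B / real N" if "coeff P j \<noteq> 0"
    proof (cases "k - j \<le> N")
      case True
      have "j \<le> ?d" using that by (rule le_degree)
      have "\<bar>1 - real (k - j) / real N\<bar> = (real N - real (k - j)) / real N"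
        using True N by (simp add: field_simps)
      also have "\<dots> \<le> real ?d / real N"
        using \<open>j \<le> ?d\<close> k by (intro divide_right_mono) auto
      finally have "\<bar>1 - real (k - j) / real N\<bar> * cmod (taylor_coeff P (k - j)) \<le> real ?d / real N * B"
        using B by (intro mult_mono) auto
      then show ?thesis using True by (simp add: coeff_W_poly norm_mult del: of_real_diff of_real_divide)
    qed (use \<open>0 \<le> B\<close> in \<open>simp add: coeff_W_poly\<close>)
    then show "cmod (coeff P j * coeff (W_poly P N) (k - j)) \<le> cmod (coeff P j) * (real ?d * B / real N)"
      by (cases "coeff P j = 0") (auto simp: norm_mult simp del: times_divide_eq_right intro!: mult_left_mono)
  qed
  also have "\<dots> = (real ?d * B / real N) * (\<Sum>j\<le>k. cmod (coeff P j))"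
    by (subst mult.commute) (rule sum_distrib_right[symmetric])
  \<comment> \<open>Coefficients beyond the degree vanish, which makes the bound independent of
    \<open>k\<close>.\<close>
  also have "(\<Sum>j\<le>k. cmod (coeff P j)) = (\<Sum>j\<in>{..k} \<inter> {..?d}. cmod (coeff P j))"
    by (rule sum.mono_neutral_right) (auto intro: le_degree)
  also have "(real ?d * B / real N) * \<dots> \<le> (real ?d * B / real N) * (\<Sum>j\<le>?d. cmod (coeff P j))"
    using \<open>0 \<le> B\<close> by (intro mult_left_mono sum_mono2) auto
  finally show ?thesis by simp
qed

text \<open>With simple poles only, the partial fractions of \<open>1 / P\<close> produce no factors
  growing with \<open>n\<close>, and the powers of \<open>inverse \<rho>\<close> have modulus at
  most 1. The sum of the moduli of the residues is therefore a bound.\<close>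

lemma taylor_coeff_bounded:
  assumes sf: "rsquarefree P" and roots: "\<And>z. poly P z = 0 \<Longrightarrow> cmod z \<ge> 1"
  obtains B where "\<And>n. cmod (taylor_coeff P n) \<le> B"
proof (cases "degree P = 0")
  case True
  then obtain c where "P = [:c:]" by (rule degree_eq_zeroE)
  then have "taylor_coeff P n = (if n = 0 then inverse c else 0)" for n
    using taylor_coeff_eq[of P n] sf by (auto simp: rsquarefree_def fps_const_inverse fps_of_poly_const)
  then show ?thesis by (intro that[of "cmod (inverse c)"]) simp
next
  case False
  have P0: "poly P 0 \<noteq> 0" using roots[of 0] by auto
  have "cmod (taylor_coeff P n) \<le> (\<Sum>\<rho>|poly P \<rho> = 0. cmod (1 / poly (pderiv P) \<rho>))" for n
  proof -
    have "taylor_coeff P n = - (\<Sum>\<rho>|poly P \<rho> = 0. 1 / poly (pderiv P) \<rho> * inverse \<rho> ^ Suc n)"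
      using fps_quotient_rsquarefree_nth[OF sf _ P0, of 1 n] False by (simp add: taylor_coeff_eq[OF P0])
    moreover have "cmod (inverse \<rho> ^ Suc n) \<le> 1" if "poly P \<rho> = 0" for \<rho>
      unfolding norm_power norm_inverse using roots[OF that] by (intro power_le_one) (auto simp: inverse_le_1_iff)
    ultimately show ?thesis
      by (auto simp: norm_mult simp del: power_Suc times_divide_eq_left intro!: sum_norm_le mult_left_le)
  qed
  then show ?thesis by (rule that)
qed

section \<open>Asymptotics of the mean square error\<close>

lemma mean_square_error_limit:
  assumes sf: "rsquarefree P" and roots: "\<And>z. poly P z = 0 \<Longrightarrow> cmod z \<ge> 1"
  shows "(\<lambda>N. real N * mean_square_error P N) \<longlonglongrightarrow> real (card (unit_circle_zeros P))"
proof -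
  let ?Z = "{z. poly P z = 0}" and ?d = "degree P"
  have P0: "poly P 0 \<noteq> 0" using roots[of 0] by auto
  have fin: "finite ?Z" using sf by (intro poly_roots_finite) (simp add: rsquarefree_def)
  obtain B where B: "\<And>n. cmod (taylor_coeff P n) \<le> B" using taylor_coeff_bounded[OF assms] by blast
  define C where "C = real ?d * B * (\<Sum>j\<le>?d. cmod (coeff P j))"
  \<comment> \<open>The tail has \<open>degree P\<close> terms, each at most
    \<open>(C / N)^2\<close>, so \<open>N * T N\<close> is \<open>O(1 / N)\<close>.\<close>
  define T where "T N = (\<Sum>k=N+1..N+?d. (cmod (coeff (error_poly P N) k))\<^sup>2)" for N
  have mse: "mean_square_error P N = (\<Sum>k\<le>N+?d. (cmod (coeff (error_poly P N) k))\<^sup>2)" for N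
    unfolding mean_square_error_def poly_error_poly[symmetric]
    by (subst parseval_poly[OF degree_error_poly]) simp
  \<comment> \<open>The inverses of the zeros lie in the closed unit disc, as
    \<open>cesaro_mean_power_sums\<close> requires. The squared factor \<open>1 / N\<close> of the
    low coefficients, multiplied by \<open>N\<close>, leaves the \<open>1 / N\<close> of a Cesaro
    mean; the coefficient at index 0 vanishes.\<close>
  have split: "real N * mean_square_error P N =
      (\<Sum>k=1..N. (cmod (\<Sum>z\<in>inverse ` ?Z. z ^ k))\<^sup>2) / real N + real N * T N" if "N \<ge> 1" for N
  proof -
    have "{..N+?d} = insert 0 {1..N} \<union> {N+1..N+?d}" by auto
    then have "mean_square_error P N = (\<Sum>k\<in>insert 0 {1..N}. (cmod (coeff (error_poly P N) k))\<^sup>2) + T N"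
      unfolding mse T_def by (simp only:) (intro sum.union_disjoint, auto)
    also have "(\<Sum>k\<in>insert 0 {1..N}. (cmod (coeff (error_poly P N) k))\<^sup>2) =
        (\<Sum>k=1..N. (cmod (coeff (error_poly P N) k))\<^sup>2)"
      by (simp add: coeff_error_poly_low[OF sf P0])
    also have "\<dots> = (\<Sum>k=1..N. (cmod (\<Sum>z\<in>inverse ` ?Z. z ^ k))\<^sup>2 / (real N)\<^sup>2)"
      by (intro sum.cong refl)
         (simp add: coeff_error_poly_low[OF sf P0] norm_divide power_divide sum.reindex[of inverse ?Z] inj_on_def o_def)
    finally show ?thesis using that
      by (simp add: sum_divide_distrib[symmetric] distrib_left power2_eq_square)
  qed
  have T: "T N \<le> real ?d * (C / real N)\<^sup>2" if "N > 0" for N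
  proof -
    have "T N \<le> (\<Sum>k=N+1..N+?d. (C / real N)\<^sup>2)" unfolding T_def C_def
      by (intro sum_mono power_mono norm_coeff_error_poly_high B) (use that in auto)
    then show ?thesis by simp
  qed
  have "(\<lambda>N. real N * T N) \<longlonglongrightarrow> 0"
  proof (rule Lim_null_comparison)
    \<comment> \<open>For \<open>N = 0\<close> both sides are 0, since division by zero yields
      0.\<close>
    have "real N * T N \<le> real ?d * C\<^sup>2 / real N" for N
      using mult_left_mono[OF T[of N], of "real N"] by (cases "N = 0") (simp_all add: power2_eq_square)
    moreover have "T N \<ge> 0" for N unfolding T_def by (intro sum_nonneg) auto
    ultimately show "eventually (\<lambda>N. norm (real N * T N) \<le> real ?d * C\<^sup>2 / real N) sequentially" by simp
    show "(\<lambda>N. real ?d * C\<^sup>2 / real N) \<longlonglongrightarrow> 0" by real_asymp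
  qed
  moreover have "(\<lambda>N. (\<Sum>k=1..N. (cmod (\<Sum>z\<in>inverse ` ?Z. z ^ k))\<^sup>2) / real N) \<longlonglongrightarrow>
      real (card {z \<in> inverse ` ?Z. cmod z = 1})"
    by (rule cesaro_mean_power_sums)
       (use fin roots in \<open>auto simp: norm_inverse inverse_le_1_iff\<close>)
  ultimately have "(\<lambda>N. (\<Sum>k=1..N. (cmod (\<Sum>z\<in>inverse ` ?Z. z ^ k))\<^sup>2) / real N + real N * T N) \<longlonglongrightarrow>
      real (card {z \<in> inverse ` ?Z. cmod z = 1})"
    using tendsto_add[where b = "0::real"] by simp
  \<comment> \<open>Inversion is injective and preserves the unit circle, so the count is that of
    the zeros themselves.\<close>
  moreover have "{z \<in> inverse ` ?Z. cmod z = 1} = inverse ` unit_circle_zeros P"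
    by (auto simp: unit_circle_zeros_def norm_inverse)
  then have "card {z \<in> inverse ` ?Z. cmod z = 1} = card (unit_circle_zeros P)"
    by (simp add: card_image inj_on_def)
  moreover have "eventually (\<lambda>N. (\<Sum>k=1..N. (cmod (\<Sum>z\<in>inverse ` ?Z. z ^ k))\<^sup>2) / real N + real N * T N =
      real N * mean_square_error P N) sequentially"
    using eventually_ge_at_top[of 1] by eventually_elim (simp add: split)
  ultimately show ?thesis by (simp add: Lim_transform_eventually)
qed

text \<open>Without zeros on the circle \<open>S\<close> is 0, and equivalence to the zero function
  would force the error to vanish eventually. The little-o form covers this case as well, while the
  equivalence is claimed only if such zeros exist.\<close>

theorem theorem2:
  fixes P :: "complex poly"
  assumes "P \<noteq> 0"
    and "\<And>z. poly P z = 0 \<Longrightarrow> order z P = 1"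
    and "\<And>z. poly P z = 0 \<Longrightarrow> cmod z \<ge> 1"
  defines "S \<equiv> (\<Sum>\<rho>\<in>unit_circle_zeros P. (real (order \<rho> P))\<^sup>2)"
  shows "(\<lambda>N. mean_square_error P N - 1 / real N * S) \<in> o(\<lambda>N. 1 / real N) \<and>
         (unit_circle_zeros P \<noteq> {} \<longrightarrow>
           (\<lambda>N. mean_square_error P N) \<sim>[at_top] (\<lambda>N. 1 / real N * S))"
proof -
  have sf: "rsquarefree P"
    unfolding rsquarefree_def using assms(1,2) by (metis order_root)
  have S: "S = real (card (unit_circle_zeros P))"
    unfolding S_def using assms(2) by (simp add: unit_circle_zeros_def)
  have lim: "(\<lambda>N. real N * mean_square_error P N) \<longlonglongrightarrow> S"
    unfolding S using mean_square_error_limit[OF sf assms(3)] .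
  have "(\<lambda>N. mean_square_error P N - 1 / real N * S) \<in> o(\<lambda>N. 1 / real N)"
  proof (rule smalloI_tendsto)
    have "eventually (\<lambda>N. real N * mean_square_error P N - S =
        (mean_square_error P N - 1 / real N * S) / (1 / real N)) sequentially"
      using eventually_gt_at_top[of 0] by eventually_elim (simp add: field_simps)
    moreover have "(\<lambda>N. real N * mean_square_error P N - S) \<longlonglongrightarrow> 0"
      using tendsto_diff[OF lim tendsto_const[of S]] by simp
    ultimately show "(\<lambda>N. (mean_square_error P N - 1 / real N * S) / (1 / real N)) \<longlonglongrightarrow> 0"
      by (rule Lim_transform_eventually[rotated])
  qed (use eventually_gt_at_top[of 0] in eventually_elim, simp)
  moreover have "(\<lambda>N. mean_square_error P N) \<sim>[at_top] (\<lambda>N. 1 / real N * S)" if "unit_circle_zeros P \<noteq> {}"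
  proof (rule asymp_equivI')
    have "finite (unit_circle_zeros P)"
      using poly_roots_finite[OF assms(1)] by (rule rev_finite_subset) (auto simp: unit_circle_zeros_def)
    \<comment> \<open>Finiteness is essential here: \<open>card\<close> of an infinite set is
      0.\<close>
    then have "S \<noteq> 0" using that S by simp
    then have "(\<lambda>N. real N * mean_square_error P N / S) \<longlonglongrightarrow> 1"
      using tendsto_divide[OF lim tendsto_const[of S]] by simp
    then show "(\<lambda>N. mean_square_error P N / (1 / real N * S)) \<longlonglongrightarrow> 1"
      by (simp add: mult.commute)
  qed
  ultimately show ?thesis by blast
qed

end
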